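(* Assume that $\eta$ has a standard normal distribution and set $s_n=2^{-1}e^{-n^2}$ for $n\in\mathbb{N}$. Then there exists a deterministic sequence $(a_k)_{k\ge1}$ of real numbers satisfying $$\sum_{k\ge1}\frac{a_k^2}{k}=\infty\quad\text{and}\quad \sum_{k\ge1}\frac{a_k^2}{k^{1+2s}}<\infty\ \text{ for every } s>0$$ for which $$\limsup_{n\to\infty}\frac{\log|X(s_n)|-n\log 2}{\log\log n}=\frac12\quad\text{a.s.}$$ and $$\liminf_{n\to\infty}\frac{\log|X(s_n)|-n\log 2}{\log n}=-1\quad\text{a.s.}$$
   Context: $\eta_1,\eta_2,\ldots$ are independent copies of the random variable $\eta$. For $s>0$, $X(s):=\sum_{k\ge1}\frac{a_k\eta_k}{k^{1/2+s}}$ (the series converges a.s. for each $s>0$). *)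

theory Defs
  imports "HOL-Probability.Probability"
begin

text \<open>
  Index \<open>k\<close> of the library series is \<open>k + 1\<close> in the mathematical series, which starts at 1;
  the values \<open>a 0\<close> and \<open>\<eta> 0\<close> are never used.
  \<open>suminf\<close> is the limit of the partial sums taken in order, so conditional convergence suffices.
  It is unspecified on outcomes where the series diverges; for independent standard normal
  \<open>\<eta>\<close> and square-summable coefficients these form a null set.
\<close>

definition X :: "(nat \<Rightarrow> real) \<Rightarrow> (nat \<Rightarrow> 'a \<Rightarrow> real) \<Rightarrow> real \<Rightarrow> 'a \<Rightarrow> real" where
  "X a \<eta> s \<omega> = (\<Sum>k. a (Suc k) * \<eta> (Suc k) \<omega> / real (Suc k) powr (1 / 2 + s))"

definition s_seq :: "nat \<Rightarrow> real" where
  "s_seq n = exp (- (real n)\<^sup>2) / 2"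

end

theory Submission
  imports Defs "HOL-Real_Asymp.Real_Asymp"
begin

text \<open>
  Let \<open>a\<close> be supported on indices \<open>k\<^sub>j\<close> with \<open>ln k\<^sub>j\<close> of order \<open>exp (j\<^sup>2 + j)\<close>, with
  \<open>a k\<^sub>j = 2 ^ j * sqrt k\<^sub>j\<close>, and put \<open>\<xi> j = \<eta> k\<^sub>j\<close>.  Since \<open>ln k\<^sub>j\<close> lies well inside the gap between
  \<open>exp (j\<^sup>2)\<close> and \<open>exp ((j + 1)\<^sup>2)\<close>, the factor \<open>k\<^sub>j powr - s_seq n\<close> is nearly 1 for \<open>j < n\<close> and nearly 0
  for \<open>j \<ge> n\<close>, so \<open>X a \<eta> (s_seq n) / 2 ^ n\<close> is within \<open>1 / n\<^sup>2\<close> of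
  \<open>Z n = (\<Sum>j<n. 2 ^ j * \<xi> j) / 2 ^ n\<close>, a centred normal variable of standard deviation between
  \<open>1 / 2\<close> and \<open>1\<close>.  The first Borel--Cantelli lemma gives \<open>\<bar>Z n\<bar> \<le> sqrt (8 * ln n)\<close> and
  \<open>\<bar>Z n\<bar> \<ge> n powr (- 1 - \<epsilon>)\<close> eventually.  Conversely \<open>\<xi> n = 2 * Z (n + 1) - Z n\<close> exceeds
  \<open>sqrt (ln n)\<close> infinitely often, so \<open>\<bar>Z n\<bar>\<close> is of this order infinitely often.  For small
  values, \<open>Z\<close> is sampled along \<open>i * block_gap i\<close> with \<open>block_gap i\<close> about \<open>3 * log 2 i\<close>: the gaps are short
  enough for \<open>\<bar>W\<^sub>i\<bar> \<le> 1 / i\<close> to happen infinitely often for the independent block sums \<open>W\<^sub>i\<close>, and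
  long enough for the contribution of the earlier blocks to be \<open>o(1 / i)\<close>.
\<close>

subsection \<open>Normal variables and Borel--Cantelli lemmas\<close>

text \<open>Each block sum is a measurable function of the variables restricted to its block, and
  restrictions to disjoint blocks are independent. Singleton blocks later yield independence of a
  subsequence.\<close>

lemma (in prob_space) indep_vars_block_sums:
  fixes X :: "'i \<Rightarrow> 'a \<Rightarrow> real"
  assumes "indep_vars (\<lambda>_. borel) X I" "\<And>j. j \<in> L \<Longrightarrow> K j \<subseteq> I" "disjoint_family_on K L"
  shows "indep_vars (\<lambda>_. borel) (\<lambda>j \<omega>. \<Sum>i\<in>K j. c j i * X i \<omega>) L"
proof -
  have "indep_vars (\<lambda>_. borel) (\<lambda>j \<omega>. (\<lambda>f. \<Sum>i\<in>K j. c j i * f i) (restrict (\<lambda>i. X i \<omega>) (K j))) L"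
    by (rule indep_vars_compose2[OF indep_vars_restrict[OF assms]]) measurable
  then show ?thesis
    by (rule indep_vars_cong[THEN iffD1, rotated -1]) (auto intro!: ext sum.cong)
qed

lemma (in prob_space) distributed_weighted_sum_normal:
  fixes X :: "'i \<Rightarrow> 'a \<Rightarrow> real"
  assumes "finite I" "I \<noteq> {}" "indep_vars (\<lambda>_. borel) X I"
    and c: "\<And>i. i \<in> I \<Longrightarrow> c i \<noteq> 0"
    and X: "\<And>i. i \<in> I \<Longrightarrow> distributed M lborel (X i) std_normal_density"
  shows "distributed M lborel (\<lambda>\<omega>. \<Sum>i\<in>I. c i * X i \<omega>) (normal_density 0 (sqrt (\<Sum>i\<in>I. (c i)\<^sup>2)))"
proof -
  have "distributed M lborel (\<lambda>\<omega>. \<Sum>i\<in>I. c i * X i \<omega>)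
      (normal_density (\<Sum>i\<in>I. 0) (sqrt (\<Sum>i\<in>I. \<bar>c i\<bar>\<^sup>2)))"
  proof (rule sum_indep_normal)
    show "indep_vars (\<lambda>i. borel) (\<lambda>i x. c i * X i x) I"
      by (rule indep_vars_compose2[OF assms(3)]) auto
    show "distributed M lborel (\<lambda>x. c i * X i x) (normal_density 0 \<bar>c i\<bar>)" if "i \<in> I" for i
      using normal_density_affine[OF X[OF that], of "c i" 0] c[OF that] by simp
  qed (use assms in auto)
  then show ?thesis by simp
qed

lemma (in prob_space) normal_prob_abs_le:
  assumes Y: "distributed M lborel Y (normal_density 0 \<sigma>)" and "\<sigma> > 0" "x \<ge> 0"
  shows "prob {\<omega>\<in>space M. \<bar>Y \<omega>\<bar> \<le> x} \<le> x / \<sigma>"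
proof -
  have le: "normal_density 0 \<sigma> y \<le> 1 / (2 * \<sigma>)" for y
  proof -
    \<comment> \<open>From \<open>2 * pi >= 4\<close> the density is at most
      \<open>1 / (2 * \<sigma>)\<close>, which cancels against the interval length
      \<open>2 * x\<close> and leaves exactly \<open>x / \<sigma>\<close>.\<close>
    have "sqrt (2 * pi * \<sigma>\<^sup>2) \<ge> sqrt (4 * \<sigma>\<^sup>2)"
      using pi_ge_two \<open>\<sigma> > 0\<close> by (intro real_sqrt_le_mono mult_right_mono) auto
    then have "sqrt (2 * pi * \<sigma>\<^sup>2) \<ge> 2 * \<sigma>"
      using \<open>\<sigma> > 0\<close> by (simp add: real_sqrt_mult)
    then have "1 / sqrt (2 * pi * \<sigma>\<^sup>2) \<le> 1 / (2 * \<sigma>)"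
      using \<open>\<sigma> > 0\<close> by (intro divide_left_mono) auto
    moreover have "exp (-(y - 0)\<^sup>2/ (2 * \<sigma>\<^sup>2)) \<le> 1"
      by simp
    ultimately have "1 / sqrt (2 * pi * \<sigma>\<^sup>2) * exp (-(y - 0)\<^sup>2/ (2 * \<sigma>\<^sup>2)) \<le> 1 / (2 * \<sigma>) * 1"
      using \<open>\<sigma> > 0\<close> by (intro mult_mono) auto
    then show ?thesis by (simp add: normal_density_def)
  qed
  have "emeasure M (Y -` {-x..x} \<inter> space M) = (\<integral>\<^sup>+y. ennreal (normal_density 0 \<sigma> y) * indicator {-x..x} y \<partial>lborel)"
    by (rule distributed_emeasure[OF Y]) auto
  also have "\<dots> \<le> (\<integral>\<^sup>+y. ennreal (1 / (2 * \<sigma>)) * indicator {-x..x} y \<partial>lborel)"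
    using le by (intro nn_integral_mono mult_right_mono ennreal_leI) auto
  also have "\<dots> = ennreal (1 / (2 * \<sigma>)) * ennreal (2 * x)"
    using assms by (subst nn_integral_cmult_indicator) auto
  also have "\<dots> = ennreal (x / \<sigma>)"
    using assms by (subst ennreal_mult[symmetric]) auto
  finally have "measure M (Y -` {-x..x} \<inter> space M) \<le> x / \<sigma>"
    using assms by (simp add: emeasure_eq_measure)
  also have "Y -` {-x..x} \<inter> space M = {\<omega>\<in>space M. \<bar>Y \<omega>\<bar> \<le> x}"
    by auto
  finally show ?thesis .
qed

text \<open>On the nonnegative half-line the density decreases, so its minimum over the interval is
  attained at the right endpoint. Both divergent series below are minorized this way.\<close>

lemma (in prob_space) normal_prob_interval_ge:
  assumes Y: "distributed M lborel Y (normal_density 0 \<sigma>)" and "\<sigma> > 0" "t \<ge> 0" "h \<ge> 0"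
  shows "prob {\<omega>\<in>space M. t \<le> Y \<omega> \<and> Y \<omega> \<le> t + h} \<ge> h * normal_density 0 \<sigma> (t + h)"
proof -
  have le: "normal_density 0 \<sigma> y \<ge> normal_density 0 \<sigma> (t + h)" if "y \<in> {t..t+h}" for y
  proof -
    have "y\<^sup>2 \<le> (t + h)\<^sup>2"
      using that assms by (intro power_mono) auto
    then show ?thesis
      using assms by (auto simp: normal_density_def intro!: divide_right_mono)
  qed
  have "ennreal (h * normal_density 0 \<sigma> (t + h)) = ennreal (normal_density 0 \<sigma> (t + h)) * ennreal h"
    using assms by (subst ennreal_mult[symmetric]) (auto simp: mult.commute)
  also have "\<dots> = (\<integral>\<^sup>+y. ennreal (normal_density 0 \<sigma> (t + h)) * indicator {t..t+h} y \<partial>lborel)"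
    using assms by (subst nn_integral_cmult_indicator) auto
  also have "\<dots> \<le> (\<integral>\<^sup>+y. ennreal (normal_density 0 \<sigma> y) * indicator {t..t+h} y \<partial>lborel)"
    using le by (intro nn_integral_mono) (auto simp: indicator_def intro!: ennreal_leI)
  also have "\<dots> = emeasure M (Y -` {t..t+h} \<inter> space M)"
    by (rule distributed_emeasure[OF Y, symmetric]) auto
  finally have "h * normal_density 0 \<sigma> (t + h) \<le> measure M (Y -` {t..t+h} \<inter> space M)"
    by (simp add: emeasure_eq_measure)
  also have "Y -` {t..t+h} \<inter> space M = {\<omega>\<in>space M. t \<le> Y \<omega> \<and> Y \<omega> \<le> t + h}"
    by auto
  finally show ?thesis .
qed

text \<open>The density of variance \<open>\<sigma>\<^sup>2\<close> is compared with \<open>sqrt 2\<close> times the one of variance \<open>2 * \<sigma>\<^sup>2\<close>.\<close>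
lemma (in prob_space) normal_prob_abs_ge:
  assumes Y: "distributed M lborel Y (normal_density 0 \<sigma>)" and "\<sigma> > 0" "t \<ge> 0"
  shows "prob {\<omega>\<in>space M. t \<le> \<bar>Y \<omega>\<bar>} \<le> sqrt 2 * exp (- t\<^sup>2 / (4 * \<sigma>\<^sup>2))"
proof -
  define C where "C = sqrt 2 * exp (- t\<^sup>2 / (4 * \<sigma>\<^sup>2))"
  have C: "C \<ge> 0" by (simp add: C_def)
  have le: "normal_density 0 \<sigma> y \<le> C * normal_density 0 (sqrt 2 * \<sigma>) y" if "t \<le> \<bar>y\<bar>" for y
  proof -
    have "t\<^sup>2 \<le> \<bar>y\<bar>\<^sup>2"
      using that assms by (intro power_mono) auto
    then have "exp (- y\<^sup>2 / (4 * \<sigma>\<^sup>2)) \<le> exp (- t\<^sup>2 / (4 * \<sigma>\<^sup>2))"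
      using assms by (auto intro!: divide_right_mono)
    moreover have "normal_density 0 \<sigma> y = normal_density 0 (sqrt 2 * \<sigma>) y * (sqrt 2 * exp (- y\<^sup>2 / (4 * \<sigma>\<^sup>2)))"
    proof -
      have "exp (- y\<^sup>2 / (2 * \<sigma>\<^sup>2)) = exp (- y\<^sup>2 / (4 * \<sigma>\<^sup>2)) * exp (- y\<^sup>2 / (4 * \<sigma>\<^sup>2))"
        using assms by (simp flip: exp_add)
      then show ?thesis
        using assms by (simp add: normal_density_def real_sqrt_mult power_mult_distrib divide_simps)
    qed
    ultimately show ?thesis
      by (simp add: C_def mult.commute mult_left_mono)
  qed
  have "emeasure M (Y -` {y. t \<le> \<bar>y\<bar>} \<inter> space M) = (\<integral>\<^sup>+y. ennreal (normal_density 0 \<sigma> y) * indicator {y. t \<le> \<bar>y\<bar>} y \<partial>lborel)"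
    by (rule distributed_emeasure[OF Y]) auto
  also have "\<dots> \<le> (\<integral>\<^sup>+y. ennreal C * ennreal (normal_density 0 (sqrt 2 * \<sigma>) y) \<partial>lborel)"
    using le C by (intro nn_integral_mono)
      (auto simp: indicator_def ennreal_mult[symmetric] intro!: ennreal_leI)
  also have "\<dots> = ennreal C * (\<integral>\<^sup>+y. ennreal (normal_density 0 (sqrt 2 * \<sigma>) y) \<partial>lborel)"
    by (rule nn_integral_cmult) auto
  also have "(\<integral>\<^sup>+y. ennreal (normal_density 0 (sqrt 2 * \<sigma>) y) \<partial>lborel) = 1"
    using assms by (subst nn_integral_eq_integral) auto
  finally have "measure M (Y -` {y. t \<le> \<bar>y\<bar>} \<inter> space M) \<le> C"
    using C by (simp add: emeasure_eq_measure)
  also have "Y -` {y. t \<le> \<bar>y\<bar>} \<inter> space M = {\<omega>\<in>space M. t \<le> \<bar>Y \<omega>\<bar>}"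
    by auto
  finally show ?thesis by (simp add: C_def)
qed

lemma (in prob_space) AE_eventually_notI:
  assumes P: "\<And>n. {\<omega>\<in>space M. P n \<omega>} \<in> events"
    and le: "\<forall>\<^sub>F n in sequentially. prob {\<omega>\<in>space M. P n \<omega>} \<le> f n" and "summable f"
  shows "AE \<omega> in M. \<forall>\<^sub>F n in sequentially. \<not> P n \<omega>"
proof -
  have "summable (\<lambda>n. prob {\<omega>\<in>space M. P n \<omega>})"
    by (rule summable_comparison_test_ev[OF _ \<open>summable f\<close>]) (use le in simp)
  then have "AE \<omega> in M. \<forall>\<^sub>F n in sequentially. \<omega> \<in> space M - {\<omega>\<in>space M. P n \<omega>}"
    using P by (intro borel_cantelli_AE1) (auto simp: emeasure_eq_measure)
  then show ?thesis
    by (auto elim!: AE_mp intro!: AE_I2 elim: eventually_mono)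
qed

text \<open>The second Borel--Cantelli lemma. By \<open>1 - p <= exp (- p)\<close>, the probability
  that no \<open>A n\<close> occurs from \<open>N\<close> on is at most the exponential of minus any
  partial sum. Were it positive, minus its logarithm would bound all partial sums.\<close>

lemma (in prob_space) borel_cantelli_indep_events:
  assumes A: "indep_events A (UNIV :: nat set)" and div: "\<not> summable (\<lambda>n. prob (A n))"
  shows "AE \<omega> in M. \<exists>\<^sub>F n in sequentially. \<omega> \<in> A n"
proof -
  have ev: "A n \<in> events" for n
    using A by (auto simp: indep_events_def)
  have null: "AE \<omega> in M. \<not> (\<forall>n\<ge>N. \<omega> \<notin> A n)" for N
  proof -
    define B where "B = {\<omega>\<in>space M. \<forall>n\<in>{N..}. \<omega> \<notin> A n}"
    have B: "B \<in> events"
      unfolding B_def using ev by measurable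
    have bound: "prob B \<le> exp (- (\<Sum>n\<in>{N..<m}. prob (A n)))" if "N < m" for m
    proof -
      have indep: "indep_events (\<lambda>n. space M - A n) {N..<m}"
      proof -
        \<comment> \<open>A singleton family is intersection stable, so independence passes to the
          generated sigma-algebras, which contain the complements.\<close>
        have "indep_sets (\<lambda>i. {A i}) {N..<m}"
          using A unfolding indep_events_def_alt by (rule indep_sets_mono_index[rotated]) auto
        then have "indep_sets (\<lambda>i. sigma_sets (space M) {A i}) {N..<m}"
          by (rule indep_sets_sigma) (auto simp: Int_stable_def)
        then show ?thesis
          unfolding indep_events_def_alt
          by (rule indep_sets_mono_sets) (auto intro: sigma_sets.Compl)
      qed
      have "prob B \<le> prob (\<Inter>n\<in>{N..<m}. space M - A n)"
        using ev that by (intro finite_measure_mono) (auto simp: B_def)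
      also have "\<dots> = (\<Prod>n\<in>{N..<m}. prob (space M - A n))"
        using indep that by (auto simp: indep_events_def)
      also have "\<dots> \<le> (\<Prod>n\<in>{N..<m}. exp (- prob (A n)))"
      proof (intro prod_mono conjI)
        fix n show "prob (space M - A n) \<le> exp (- prob (A n))"
          using exp_ge_add_one_self[of "- prob (A n)"] ev by (simp add: prob_compl)
      qed auto
      also have "\<dots> = exp (- (\<Sum>n\<in>{N..<m}. prob (A n)))"
        by (simp add: exp_sum[symmetric] sum_negf)
      finally show ?thesis .
    qed
    have "prob B = 0"
    proof (rule ccontr)
      assume "prob B \<noteq> 0"
      then have pos: "prob B > 0"
        using measure_nonneg[of M B] by linarith
      have "summable (\<lambda>n. prob (A (n + N)))"
      proof (rule bounded_imp_summable)
        fix m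
        have "(\<Sum>n\<le>m. prob (A (n + N))) = (\<Sum>n\<in>{N..<N + Suc m}. prob (A n))"
          by (rule sum.reindex_bij_witness[of _ "\<lambda>n. n - N" "\<lambda>n. n + N"]) auto
        moreover have "ln (prob B) \<le> - (\<Sum>n\<in>{N..<N + Suc m}. prob (A n))"
          using bound[of "N + Suc m"] pos ln_mono[of "prob B"] by fastforce
        ultimately show "(\<Sum>n\<le>m. prob (A (n + N))) \<le> - ln (prob B)"
          by simp
      qed auto
      then show False
        using div summable_iff_shift[of "\<lambda>n. prob (A n)" N] by simp
    qed
    then have "B \<in> null_sets M"
      using B by (auto simp: emeasure_eq_measure null_sets_def)
    then have "AE \<omega> in M. \<omega> \<notin> B"
      by (rule AE_not_in)
    then show ?thesis
      by (rule AE_mp) (auto simp: B_def intro!: AE_I2)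
  qed
  have "AE \<omega> in M. \<forall>N. \<not> (\<forall>n\<ge>N. \<omega> \<notin> A n)"
    using null by (simp add: AE_all_countable)
  then show ?thesis
    by (simp add: frequently_def eventually_sequentially)
qed

lemma (in prob_space) AE_frequentlyI_indep_vars:
  assumes "indep_vars (\<lambda>_. borel) Y (UNIV :: nat set)" and P: "\<And>n. {x. P n x} \<in> sets borel"
    and le: "\<forall>\<^sub>F n in sequentially. f n \<le> prob {\<omega>\<in>space M. P n (Y n \<omega>)}"
    and f: "\<not> summable f" "\<forall>\<^sub>F n in sequentially. f n \<ge> (0::real)"
  shows "AE \<omega> in M. \<exists>\<^sub>F n in sequentially. P n (Y n \<omega>)"
proof -
  have "\<not> summable (\<lambda>n. prob {\<omega>\<in>space M. P n (Y n \<omega>)})"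
  proof
    assume "summable (\<lambda>n. prob {\<omega>\<in>space M. P n (Y n \<omega>)})"
    then have "summable f"
      by (rule summable_comparison_test_ev[rotated]) (use eventually_conj[OF le f(2)] in \<open>auto elim: eventually_mono\<close>)
    with f show False by simp
  qed
  then have "AE \<omega> in M. \<exists>\<^sub>F n in sequentially. \<omega> \<in> {\<omega>\<in>space M. P n (Y n \<omega>)}"
    using assms(1) P by (intro borel_cantelli_indep_events indep_eventsI_indep_vars) auto
  then show ?thesis
    by (rule AE_mp) (auto intro!: AE_I2 elim: frequently_elim1)
qed

subsection \<open>Sparse coefficients\<close>

text \<open>The exponent is, up to the constant 1/2, the midpoint of \<open>j^2\<close> and
  \<open>(j + 1)^2\<close>, the exponents in \<open>1 / s_seq\<close>. The value is a position in
  the library series; the mathematical index is \<open>Suc (sparse_index j)\<close>.\<close>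

definition sparse_index :: "nat \<Rightarrow> nat" where
  "sparse_index j = nat \<lfloor>exp (exp ((real j)\<^sup>2 + real j))\<rfloor>"

text \<open>\<open>inv\<close> recovers \<open>j\<close> from the index, which is legitimate because
  \<open>sparse_index\<close> is injective. The square root cancels \<open>k powr (1 / 2)\<close> in
  the series and leaves the weight \<open>2 ^ j\<close>.\<close>

definition sparse_coeff :: "nat \<Rightarrow> real" where
  "sparse_coeff k = (if k \<in> range (\<lambda>j. Suc (sparse_index j))
     then 2 ^ inv (\<lambda>j. Suc (sparse_index j)) k * sqrt (real k) else 0)"

text \<open>The inner exponentials differ by at least 1, hence so do the outer ones, and a gap of 1
  survives taking floors.\<close>

lemma strict_mono_sparse_index: "strict_mono sparse_index"
  unfolding strict_mono_Suc_iff
proof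
  fix j
  define x where "x = exp ((real j)\<^sup>2 + real j)"
  define y where "y = exp ((real (Suc j))\<^sup>2 + real (Suc j))"
  have "x \<ge> 1"
    by (simp add: x_def)
  have "x + 1 \<le> 2 * x"
    using \<open>x \<ge> 1\<close> by simp
  also have "2 * x \<le> exp 1 * x"
    using exp_ge_add_one_self[of 1] \<open>x \<ge> 1\<close> by (intro mult_right_mono) auto
  also have "\<dots> \<le> y"
    by (simp add: x_def y_def power2_eq_square algebra_simps flip: exp_add)
  finally have "x + 1 \<le> y" .
  have "exp x + 1 \<le> 2 * exp x"
    using \<open>x \<ge> 1\<close> by simp
  also have "\<dots> \<le> exp 1 * exp x"
    using exp_ge_add_one_self[of 1] by (intro mult_right_mono) auto
  also have "\<dots> \<le> exp y"
    using \<open>x + 1 \<le> y\<close> by (simp flip: exp_add)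
  finally have "\<lfloor>exp x\<rfloor> < \<lfloor>exp y\<rfloor>"
    by linarith
  moreover have "\<lfloor>exp x\<rfloor> \<ge> 0"
    by simp
  ultimately show "sparse_index j < sparse_index (Suc j)"
    unfolding sparse_index_def x_def y_def by linarith
qed

text \<open>The successor compensates the floor from below. From above, adding 1 at most doubles
  \<open>exp (E j)\<close>, and \<open>2 <= exp 1 <= exp (E j)\<close>.\<close>

lemma ln_sparse_index_bounds:
  defines "E \<equiv> \<lambda>j. exp ((real j)\<^sup>2 + real j)"
  shows "E j \<le> ln (real (Suc (sparse_index j)))" "ln (real (Suc (sparse_index j))) \<le> 2 * E j"
proof -
  have E: "E j \<ge> 1"
    by (simp add: E_def)
  have eq: "real (Suc (sparse_index j)) = of_int \<lfloor>exp (E j)\<rfloor> + 1"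
    by (simp add: sparse_index_def E_def)
  have "exp (E j) \<le> real (Suc (sparse_index j))"
    unfolding eq by linarith
  then show "E j \<le> ln (real (Suc (sparse_index j)))"
    by (subst ln_ge_iff) auto
  have "real (Suc (sparse_index j)) \<le> exp (E j) + 1"
    unfolding eq by linarith
  also have "\<dots> \<le> 2 * exp (E j)"
    using E by simp
  also have "\<dots> \<le> exp 1 * exp (E j)"
    using exp_ge_add_one_self[of 1] by (intro mult_right_mono) auto
  also have "\<dots> \<le> exp (2 * E j)"
    using E by (simp flip: exp_add)
  finally have "ln (real (Suc (sparse_index j))) \<le> ln (exp (2 * E j))"
    by (subst ln_le_cancel_iff) auto
  then show "ln (real (Suc (sparse_index j))) \<le> 2 * E j"
    by simp
qed

lemma sparse_coeff_sparse_index: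
  "sparse_coeff (Suc (sparse_index j)) = 2 ^ j * sqrt (real (Suc (sparse_index j)))"
proof -
  have "inj (\<lambda>j. Suc (sparse_index j))"
    using strict_mono_imp_inj_on[OF strict_mono_sparse_index] by (auto simp: inj_on_def)
  from inv_f_f[OF this, of j] show ?thesis
    by (simp add: sparse_coeff_def)
qed

lemma sparse_coeff_sparse_index_square:
  "(sparse_coeff (Suc (sparse_index j)))\<^sup>2 = 4 ^ j * real (Suc (sparse_index j))"
proof -
  have "(2 ^ j)\<^sup>2 = (4 ^ j :: real)"
    by (simp add: power2_eq_square flip: power_mult_distrib)
  then show ?thesis
    by (simp add: sparse_coeff_sparse_index power_mult_distrib del: of_nat_Suc)
qed

lemma sparse_coeff_eq_0: "n \<notin> range sparse_index \<Longrightarrow> sparse_coeff (Suc n) = 0"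
  by (auto simp: sparse_coeff_def)

text \<open>Along the support the terms are \<open>4 ^ j\<close>.\<close>

lemma not_summable_sparse_coeff: "\<not> summable (\<lambda>k. (sparse_coeff (Suc k))\<^sup>2 / real (Suc k))"
proof
  assume "summable (\<lambda>k. (sparse_coeff (Suc k))\<^sup>2 / real (Suc k))"
  then have "summable (\<lambda>j. (sparse_coeff (Suc (sparse_index j)))\<^sup>2 / real (Suc (sparse_index j)))"
    by (subst summable_mono_reindex[OF strict_mono_sparse_index, 
          where f = "\<lambda>k. (sparse_coeff (Suc k))\<^sup>2 / real (Suc k)"]) (auto simp: sparse_coeff_eq_0)
  also have "(\<lambda>j. (sparse_coeff (Suc (sparse_index j)))\<^sup>2 / real (Suc (sparse_index j))) = (\<lambda>j. 4 ^ j)"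
    by (simp add: sparse_coeff_sparse_index_square del: of_nat_Suc)
  finally show False
    by (simp add: summable_geometric_iff)
qed

text \<open>Along the support the terms are \<open>4 ^ j * exp (- 2 * s * ln k)\<close>, and
  \<open>ln k >= exp j\<close> makes the decay doubly exponential for every fixed
  \<open>s > 0\<close>.\<close>

lemma summable_sparse_coeff:
  assumes "s > 0"
  shows "summable (\<lambda>k. (sparse_coeff (Suc k))\<^sup>2 / real (Suc k) powr (1 + 2 * s))"
proof -
  define f where "f k = (sparse_coeff (Suc k))\<^sup>2 / real (Suc k) powr (1 + 2 * s)" for k
  have "summable (\<lambda>j. f (sparse_index j))"
  proof (rule summable_comparison_test)
    show "summable (\<lambda>j. 4 ^ j * exp (- 2 * s * exp (real j)))"
    proof (rule summable_comparison_test_bigo)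
      show "summable (\<lambda>j. norm ((1 / 2 :: real) ^ j))"
        by (simp add: summable_geometric_iff)
      show "(\<lambda>j. 4 ^ j * exp (- 2 * s * exp (real j))) \<in> O(\<lambda>j. (1 / 2) ^ j)"
        using assms by real_asymp
    qed
    have "f (sparse_index j) \<le> 4 ^ j * exp (- 2 * s * exp (real j))" for j
    proof -
      define k where "k = Suc (sparse_index j)"
      have "k > 0" by (simp add: k_def)
      have "exp (real j) \<le> exp ((real j)\<^sup>2 + real j)"
        by simp
      also have "\<dots> \<le> ln k"
        using ln_sparse_index_bounds(1)[of j] by (simp add: k_def)
      finally have "exp (- 2 * s * ln k) \<le> exp (- 2 * s * exp (real j))"
        using assms by simp
      moreover have "f (sparse_index j) = 4 ^ j * exp (- 2 * s * ln k)"
      proof -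
        have "real k powr (1 + 2 * s) = real k * exp (2 * s * ln k)"
          using \<open>k > 0\<close> by (simp add: powr_add) (simp add: powr_def)
        moreover have "f (sparse_index j) = 4 ^ j * real k / real k powr (1 + 2 * s)"
          by (simp add: f_def sparse_coeff_sparse_index_square k_def)
        ultimately show ?thesis
          using \<open>k > 0\<close> by (simp add: exp_minus divide_inverse)
      qed
      ultimately show ?thesis by simp
    qed
    moreover have "f k \<ge> 0" for k
      by (simp add: f_def)
    ultimately show "\<exists>N. \<forall>n\<ge>N. norm (f (sparse_index n)) \<le> 4 ^ n * exp (- 2 * s * exp (real n))"
      by auto
  qed
  then have "summable f"
    by (subst (asm) summable_mono_reindex[OF strict_mono_sparse_index])
      (auto simp: f_def sparse_coeff_eq_0)
  then show ?thesis by (simp add: f_def[abs_def])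
qed

text \<open>Dropping zero terms leaves \<open>suminf\<close> unchanged for every outcome, including
  those where the series diverges.\<close>

lemma X_sparse_coeff:
  "X sparse_coeff \<eta> s \<omega>
     = (\<Sum>j. 2 ^ j * \<eta> (Suc (sparse_index j)) \<omega> * real (Suc (sparse_index j)) powr - s)"
proof -
  define f where "f k = sparse_coeff (Suc k) * \<eta> (Suc k) \<omega> / real (Suc k) powr (1 / 2 + s)" for k
  have "X sparse_coeff \<eta> s \<omega> = suminf f"
    by (simp add: X_def f_def[abs_def])
  also have "\<dots> = (\<Sum>j. f (sparse_index j))"
    by (rule suminf_mono_reindex[OF strict_mono_sparse_index, symmetric])
      (auto simp: f_def sparse_coeff_eq_0)
  also have "(\<lambda>j. f (sparse_index j))
      = (\<lambda>j. 2 ^ j * \<eta> (Suc (sparse_index j)) \<omega> * real (Suc (sparse_index j)) powr - s)"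
    by (simp add: f_def sparse_coeff_sparse_index powr_add powr_half_sqrt powr_minus_divide
        del: of_nat_Suc)
  finally show ?thesis .
qed

section \<open>Approximation of the series by dyadic partial sums\<close>

lemma sparse_weight_less:
  assumes "j < n"
  shows "\<bar>real (Suc (sparse_index j)) powr - s_seq n - 1\<bar> \<le> exp (- real n)"
proof -
  define L where "L = ln (real (Suc (sparse_index j)))"
  have L: "L \<le> 2 * exp ((real j)\<^sup>2 + real j)" "L \<ge> 0"
    using ln_sparse_index_bounds[of j] by (auto simp: L_def)
  \<comment> \<open>The factor 2 from the bound on the logarithm cancels the 1/2 in
    \<open>s_seq\<close>.\<close>
  have "s_seq n * L \<le> (exp (- (real n)\<^sup>2) / 2) * (2 * exp ((real j)\<^sup>2 + real j))"
    unfolding s_seq_def using L by (intro mult_left_mono) auto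
  also have "\<dots> = exp ((real j)\<^sup>2 + real j - (real n)\<^sup>2)"
    by (simp add: exp_diff exp_minus field_simps)
  also have "(real j)\<^sup>2 + real j - (real n)\<^sup>2 \<le> - real n"
  proof -
    \<comment> \<open>Since \<open>j <= n - 1\<close>, the exponent \<open>j^2 + j\<close> falls
      short of \<open>n^2\<close> by at least \<open>n\<close>.\<close>
    have "real j * (real j + 1) \<le> (real n - 1) * real n"
      using assms by (intro mult_mono) auto
    then show ?thesis by (simp add: power2_eq_square algebra_simps)
  qed
  then have "exp ((real j)\<^sup>2 + real j - (real n)\<^sup>2) \<le> exp (- real n)"
    by simp
  finally have "s_seq n * L \<le> exp (- real n)" .
  moreover have "exp (- (s_seq n * L)) \<ge> 1 - s_seq n * L"
    using exp_ge_add_one_self[of "- (s_seq n * L)"] by simp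
  moreover have "exp (- (s_seq n * L)) \<le> 1"
    using L by (simp add: s_seq_def)
  ultimately show ?thesis
    by (auto simp: powr_def L_def abs_le_iff)
qed

text \<open>For \<open>j >= n\<close> the factor \<open>exp (j^2)\<close> absorbs
  \<open>exp (- n^2)\<close> and \<open>exp j / 2\<close> remains. The bound does not involve
  \<open>n\<close>, so one convergent series dominates all tails.\<close>

lemma sparse_weight_ge:
  assumes "n \<le> j"
  shows "real (Suc (sparse_index j)) powr - s_seq n \<le> exp (- exp (real j) / 2)"
proof -
  define L where "L = ln (real (Suc (sparse_index j)))"
  have L: "exp ((real j)\<^sup>2 + real j) \<le> L"
    using ln_sparse_index_bounds[of j] by (auto simp: L_def)
  have "(real n)\<^sup>2 \<le> (real j)\<^sup>2"
    using assms by (intro power_mono) auto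
  then have "exp (real j) / 2 \<le> exp ((real j)\<^sup>2 + real j - (real n)\<^sup>2) / 2"
    by simp
  also have "\<dots> = (exp (- (real n)\<^sup>2) / 2) * exp ((real j)\<^sup>2 + real j)"
    by (simp add: exp_diff exp_minus field_simps)
  also have "\<dots> \<le> s_seq n * L"
    unfolding s_seq_def using L by (intro mult_left_mono) auto
  finally show ?thesis
    by (simp add: powr_def L_def)
qed

lemma summable_sparse_tail: "summable (\<lambda>j. 2 ^ j * (real j + 1) * exp (- exp (real j) / 2))"
proof (rule summable_comparison_test_bigo)
  show "summable (\<lambda>j. norm ((1 / 2 :: real) ^ j))"
    by (simp add: summable_geometric_iff)
  show "(\<lambda>j. 2 ^ j * (real j + 1) * exp (- exp (real j) / 2)) \<in> O(\<lambda>j. (1 / 2) ^ j)"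
    by real_asymp
qed

lemma weighted_partial_sum_bound:
  fixes \<xi> :: "nat \<Rightarrow> real"
  assumes "\<And>j. \<bar>\<xi> j\<bar> \<le> C * (real j + 1)"
  shows "(\<Sum>j<n. 2 ^ j * \<bar>\<xi> j\<bar>) \<le> C * real n * 2 ^ n"
proof -
  have "C \<ge> 0"
    using assms[of 0] by simp
  have "(\<Sum>j<n. 2 ^ j * \<bar>\<xi> j\<bar>) \<le> (\<Sum>j<n. 2 ^ j * (C * real n))"
  proof (intro sum_mono mult_left_mono)
    fix j assume "j \<in> {..<n}"
    then have "C * (real j + 1) \<le> C * real n"
      using \<open>C \<ge> 0\<close> by (intro mult_left_mono) auto
    then show "\<bar>\<xi> j\<bar> \<le> C * real n"
      using assms[of j] by simp
  qed auto
  also have "\<dots> = (2 ^ n - 1) * (C * real n)"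
    by (simp add: sum_distrib_right[symmetric] geometric_sum)
  also have "\<dots> \<le> C * real n * 2 ^ n"
    using \<open>C \<ge> 0\<close> by (simp add: algebra_simps)
  finally show ?thesis .
qed

text \<open>The series is split at \<open>n\<close>: below, each weight differs from 1 by at most
  \<open>exp (- n)\<close>; above, the terms are dominated by a fixed summable sequence. The tail
  bound need not decay in \<open>n\<close>, because division by \<open>2 ^ n\<close>
  follows.\<close>

lemma sparse_sum_approximation:
  fixes \<xi> :: "nat \<Rightarrow> real"
  assumes \<xi>: "\<And>j. \<bar>\<xi> j\<bar> \<le> C * (real j + 1)"
  shows "\<bar>(\<Sum>j. 2 ^ j * \<xi> j * real (Suc (sparse_index j)) powr - s_seq n) - (\<Sum>j<n. 2 ^ j * \<xi> j)\<bar>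
    \<le> C * real n * 2 ^ n * exp (- real n) + C * (\<Sum>j. 2 ^ j * (real j + 1) * exp (- exp (real j) / 2))"
proof -
  define w where "w j = real (Suc (sparse_index j)) powr - s_seq n" for j
  define T where "T j = 2 ^ j * (real j + 1) * exp (- exp (real j) / 2)" for j
  have "C \<ge> 0"
    using \<xi>[of 0] by simp
  have T: "summable T" "\<And>j. T j \<ge> 0"
    using summable_sparse_tail by (auto simp: T_def[abs_def])
  have le: "\<bar>2 ^ j * \<xi> j * w j\<bar> \<le> C * T j" if "n \<le> j" for j
  proof -
    have "\<bar>2 ^ j * \<xi> j * w j\<bar> = 2 ^ j * \<bar>\<xi> j\<bar> * w j"
      by (simp add: abs_mult w_def)
    also have "\<dots> \<le> 2 ^ j * (C * (real j + 1)) * exp (- exp (real j) / 2)"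
      unfolding w_def using \<xi>[of j] sparse_weight_ge[OF that] by (intro mult_mono) auto
    finally show ?thesis by (simp add: T_def algebra_simps)
  qed
  have sum: "summable (\<lambda>j. 2 ^ j * \<xi> j * w j)"
    by (rule summable_comparison_test[OF _ summable_mult[OF T(1), of C]]) (use le in auto)
  have "(\<Sum>j. 2 ^ j * \<xi> j * w j) - (\<Sum>j<n. 2 ^ j * \<xi> j)
      = (\<Sum>j<n. 2 ^ j * \<xi> j * (w j - 1)) + (\<Sum>j. 2 ^ (j + n) * \<xi> (j + n) * w (j + n))"
    by (subst suminf_split_initial_segment[OF sum, of n]) (simp add: sum_subtractf algebra_simps)
  moreover have "\<bar>\<Sum>j<n. 2 ^ j * \<xi> j * (w j - 1)\<bar> \<le> C * real n * 2 ^ n * exp (- real n)"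
  proof -
    have "\<bar>\<Sum>j<n. 2 ^ j * \<xi> j * (w j - 1)\<bar> \<le> (\<Sum>j<n. \<bar>2 ^ j * \<xi> j * (w j - 1)\<bar>)"
      by (rule sum_abs)
    also have "\<dots> \<le> (\<Sum>j<n. 2 ^ j * \<bar>\<xi> j\<bar> * exp (- real n))"
    proof (rule sum_mono)
      fix j assume "j \<in> {..<n}"
      then have "\<bar>w j - 1\<bar> \<le> exp (- real n)"
        unfolding w_def by (intro sparse_weight_less) auto
      then show "\<bar>2 ^ j * \<xi> j * (w j - 1)\<bar> \<le> 2 ^ j * \<bar>\<xi> j\<bar> * exp (- real n)"
        by (simp add: abs_mult mult_left_mono)
    qed
    also have "\<dots> = (\<Sum>j<n. 2 ^ j * \<bar>\<xi> j\<bar>) * exp (- real n)"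
      by (simp add: sum_distrib_right)
    also have "\<dots> \<le> C * real n * 2 ^ n * exp (- real n)"
      using weighted_partial_sum_bound[OF \<xi>] by (intro mult_right_mono) auto
    finally show ?thesis .
  qed
  moreover have "\<bar>\<Sum>j. 2 ^ (j + n) * \<xi> (j + n) * w (j + n)\<bar> \<le> C * suminf T"
  proof -
    have "\<bar>\<Sum>j. 2 ^ (j + n) * \<xi> (j + n) * w (j + n)\<bar> \<le> (\<Sum>j. C * T (j + n))"
      unfolding real_norm_def[symmetric]
      by (intro norm_suminf_le) (use le T in \<open>auto simp: summable_iff_shift[of T n] intro!: summable_mult\<close>)
    also have "\<dots> = C * (\<Sum>j. T (j + n))"
      using T by (intro suminf_mult) (simp add: summable_iff_shift[of T n])
    also have "\<dots> \<le> C * suminf T"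
      using suminf_split_initial_segment[OF T(1), of n] sum_nonneg[of "{..<n}" T] T(2) \<open>C \<ge> 0\<close>
      by (intro mult_left_mono) auto
    finally show ?thesis .
  qed
  ultimately show ?thesis
    unfolding T_def w_def by linarith
qed

text \<open>Multiplied by \<open>n^2\<close>, both error terms tend to 0. The rate
  \<open>1 / n^2\<close> is negligible against the smallest values of \<open>Z\<close>, which are
  close to order \<open>1 / n\<close>.\<close>

lemma X_sparse_coeff_approximation:
  assumes "\<And>j. \<bar>\<eta> (Suc (sparse_index j)) \<omega>\<bar> \<le> C * (real j + 1)"
  shows "\<forall>\<^sub>F n in sequentially.
    \<bar>X sparse_coeff \<eta> (s_seq n) \<omega> / 2 ^ n - (\<Sum>j<n. 2 ^ j * \<eta> (Suc (sparse_index j)) \<omega>) / 2 ^ n\<bar>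
      \<le> 1 / (real n)\<^sup>2"
proof -
  define K where "K = (\<Sum>j. 2 ^ j * (real j + 1) * exp (- exp (real j) / 2))"
  have "((\<lambda>n. C * (real n ^ 3 * exp (- real n)) + C * K * ((real n)\<^sup>2 / 2 ^ n)) \<longlongrightarrow> C * 0 + C * K * 0) sequentially"
    by (intro tendsto_intros; real_asymp)
  then have "\<forall>\<^sub>F n in sequentially. C * (real n ^ 3 * exp (- real n)) + C * K * ((real n)\<^sup>2 / 2 ^ n) < 1"
    by (rule order_tendstoD) auto
  then show ?thesis
    using eventually_gt_at_top[of 0]
  proof eventually_elim
    case (elim n)
    define S where "S = (\<Sum>j<n. 2 ^ j * \<eta> (Suc (sparse_index j)) \<omega>)"
    have "\<bar>X sparse_coeff \<eta> (s_seq n) \<omega> - S\<bar> \<le> C * real n * 2 ^ n * exp (- real n) + C * K"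
      unfolding X_sparse_coeff S_def K_def using assms by (rule sparse_sum_approximation)
    then have "\<bar>X sparse_coeff \<eta> (s_seq n) \<omega> - S\<bar> / 2 ^ n * (real n)\<^sup>2
        \<le> (C * real n * 2 ^ n * exp (- real n) + C * K) / 2 ^ n * (real n)\<^sup>2"
      by (intro mult_right_mono divide_right_mono) auto
    also have "\<dots> = C * (real n ^ 3 * exp (- real n)) + C * K * ((real n)\<^sup>2 / 2 ^ n)"
      by (simp add: field_simps power2_eq_square power3_eq_cube)
    also have "\<dots> \<le> 1"
      using elim by simp
    finally have "\<bar>X sparse_coeff \<eta> (s_seq n) \<omega> - S\<bar> / 2 ^ n \<le> 1 / (real n)\<^sup>2"
      using elim by (simp add: pos_le_divide_eq)
    then show ?case
      by (simp add: S_def diff_divide_distrib[symmetric])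
  qed
qed

subsection \<open>Logarithmic upper and lower limits\<close>

text \<open>Otherwise some \<open>c\<close> strictly between the upper limit and \<open>l\<close>
  would eventually separate \<open>x n\<close> from \<open>u n\<close>.\<close>

lemma ereal_le_limsup_frequently:
  fixes x :: "nat \<Rightarrow> ereal"
  assumes "\<exists>\<^sub>F n in sequentially. ereal (u n) \<le> x n" "u \<longlonglongrightarrow> l"
  shows "ereal l \<le> limsup x"
proof (rule ccontr)
  assume "\<not> ereal l \<le> limsup x"
  then obtain c where c: "limsup x < c" "c < ereal l"
    using dense[of "limsup x" "ereal l"] by (auto simp: not_le)
  have "(\<lambda>n. ereal (u n)) \<longlonglongrightarrow> ereal l"
    using assms by simp
  then have "\<forall>\<^sub>F n in sequentially. c < ereal (u n)"
    using c(2) by (rule order_tendstoD)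
  with Limsup_lessD[OF c(1)] have "\<forall>\<^sub>F n in sequentially. \<not> ereal (u n) \<le> x n"
    by eventually_elim auto
  with assms(1) show False
    by (simp add: frequently_def)
qed

lemma liminf_le_ereal_frequently:
  fixes x :: "nat \<Rightarrow> ereal"
  assumes "\<exists>\<^sub>F n in sequentially. x n \<le> ereal (u n)" "u \<longlonglongrightarrow> l"
  shows "liminf x \<le> ereal l"
proof (rule ccontr)
  assume "\<not> liminf x \<le> ereal l"
  then obtain c where c: "c < liminf x" "ereal l < c"
    using dense[of "ereal l" "liminf x"] by (auto simp: not_le)
  have "(\<lambda>n. ereal (u n)) \<longlonglongrightarrow> ereal l"
    using assms by simp
  then have "\<forall>\<^sub>F n in sequentially. ereal (u n) < c"
    using c(2) by (rule order_tendstoD)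
  with less_LiminfD[OF c(1)] have "\<forall>\<^sub>F n in sequentially. \<not> x n \<le> ereal (u n)"
    by eventually_elim auto
  with assms(1) show False
    by (simp add: frequently_def)
qed

text \<open>Constant factors vanish after taking logarithms and dividing by
  \<open>ln (ln n)\<close>; only the exponent 1/2 of \<open>ln n\<close> survives.\<close>

lemma limsup_ln_over_ln_ln:
  fixes y :: "nat \<Rightarrow> real"
  assumes pos: "\<forall>\<^sub>F n in sequentially. y n > 0"
    and upper: "\<forall>\<^sub>F n in sequentially. y n \<le> sqrt (8 * ln (real n)) + 1 / (real n)\<^sup>2"
    and lower: "\<exists>\<^sub>F n in sequentially. y n \<ge> sqrt (ln (real n)) / 16"
  shows "limsup (\<lambda>n. ereal (ln (y n) / ln (ln (real n)))) = ereal (1 / 2)"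
proof (rule antisym)
  have lnln: "\<forall>\<^sub>F n in sequentially. ln (ln (real n)) > 0" "\<forall>\<^sub>F n in sequentially. ln (real n) > 0"
    by real_asymp+
  define v where "v n = ln (sqrt (8 * ln (real n)) + 1 / (real n)\<^sup>2) / ln (ln (real n))" for n
  have "\<forall>\<^sub>F n in sequentially. ereal (ln (y n) / ln (ln (real n))) \<le> ereal (v n)"
    using pos upper lnln
  proof eventually_elim
    case (elim n)
    then have "ln (y n) \<le> ln (sqrt (8 * ln (real n)) + 1 / (real n)\<^sup>2)"
      by (intro ln_mono) auto
    then show ?case
      using elim by (auto simp: v_def intro!: divide_right_mono)
  qed
  then have "limsup (\<lambda>n. ereal (ln (y n) / ln (ln (real n)))) \<le> limsup (\<lambda>n. ereal (v n))"
    by (rule Limsup_mono)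
  also have "\<dots> = ereal (1 / 2)"
  proof (rule lim_imp_Limsup)
    have "v \<longlonglongrightarrow> 1 / 2"
      unfolding v_def by real_asymp
    then show "(\<lambda>n. ereal (v n)) \<longlonglongrightarrow> ereal (1 / 2)"
      by simp
  qed simp
  finally show "limsup (\<lambda>n. ereal (ln (y n) / ln (ln (real n)))) \<le> ereal (1 / 2)" .
  show "ereal (1 / 2) \<le> limsup (\<lambda>n. ereal (ln (y n) / ln (ln (real n))))"
  proof (rule ereal_le_limsup_frequently)
    show "(\<lambda>n. ln (sqrt (ln (real n)) / 16) / ln (ln (real n))) \<longlonglongrightarrow> 1 / 2"
      by real_asymp
    have "\<forall>\<^sub>F n in sequentially. y n \<ge> sqrt (ln (real n)) / 16 \<longrightarrow>
        ereal (ln (sqrt (ln (real n)) / 16) / ln (ln (real n))) \<le> ereal (ln (y n) / ln (ln (real n)))"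
      using lnln by eventually_elim (auto intro!: divide_right_mono ln_mono)
    then show "\<exists>\<^sub>F n in sequentially.
        ereal (ln (sqrt (ln (real n)) / 16) / ln (ln (real n))) \<le> ereal (ln (y n) / ln (ln (real n)))"
      using lower by (rule frequently_rev_mp[rotated])
  qed
qed

text \<open>The logarithmic factor in \<open>upper\<close> contributes
  \<open>ln (ln n) / ln n\<close>, which tends to 0. The lower bounds form a countable family of
  exponents approaching -1, so that a single null set suffices when they hold almost surely.\<close>

lemma liminf_ln_over_ln:
  fixes y :: "nat \<Rightarrow> real"
  assumes lower: "\<And>m. \<forall>\<^sub>F n in sequentially. y n \<ge> real n powr (- 1 - 1 / (real m + 2)) / 2"
    and upper: "\<exists>\<^sub>F n in sequentially. y n \<le> 3 * (3 * log 2 (real n + 1) + 1) / real n"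
  shows "liminf (\<lambda>n. ereal (ln (y n) / ln (real n))) = ereal (- 1)"
proof (rule antisym)
  have pos: "\<forall>\<^sub>F n in sequentially. y n > 0"
    using lower[of 0] eventually_gt_at_top[of 0]
  proof eventually_elim
    case (elim n)
    then have "real n powr (- 1 - 1 / (real 0 + 2)) / 2 > 0"
      by simp
    with elim show ?case by linarith
  qed
  have ln: "\<forall>\<^sub>F n in sequentially. ln (real n) > 0"
    by real_asymp
  show "liminf (\<lambda>n. ereal (ln (y n) / ln (real n))) \<le> ereal (- 1)"
  proof (rule liminf_le_ereal_frequently)
    show "(\<lambda>n. ln (3 * (3 * log 2 (real n + 1) + 1) / real n) / ln (real n)) \<longlonglongrightarrow> - 1"
      by real_asymp
    have "\<forall>\<^sub>F n in sequentially. y n \<le> 3 * (3 * log 2 (real n + 1) + 1) / real n \<longrightarrow>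
        ereal (ln (y n) / ln (real n)) \<le> ereal (ln (3 * (3 * log 2 (real n + 1) + 1) / real n) / ln (real n))"
      using ln pos by eventually_elim (auto intro!: divide_right_mono ln_mono)
    then show "\<exists>\<^sub>F n in sequentially.
        ereal (ln (y n) / ln (real n)) \<le> ereal (ln (3 * (3 * log 2 (real n + 1) + 1) / real n) / ln (real n))"
      using upper by (rule frequently_rev_mp[rotated])
  qed
  have bound: "ereal (- 1 - 1 / (real m + 2)) \<le> liminf (\<lambda>n. ereal (ln (y n) / ln (real n)))" for m
  proof -
    define \<epsilon> where "\<epsilon> = 1 / (real m + 2)"
    \<comment> \<open>This is the logarithm of the lower bound divided by \<open>ln n\<close>; its
      last term comes from the factor 1/2.\<close>
    define v where "v n = - 1 - \<epsilon> - ln 2 / ln (real n)" for n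
    have "(\<lambda>n. ln 2 / ln (real n)) \<longlonglongrightarrow> 0"
      by real_asymp
    then have "v \<longlonglongrightarrow> - 1 - \<epsilon> - 0"
      unfolding v_def by (intro tendsto_intros)
    then have "ereal (- 1 - \<epsilon>) = liminf (\<lambda>n. ereal (v n))"
      by (intro lim_imp_Liminf[symmetric]) auto
    also have "\<dots> \<le> liminf (\<lambda>n. ereal (ln (y n) / ln (real n)))"
    proof (rule Liminf_mono)
      show "\<forall>\<^sub>F n in sequentially. ereal (v n) \<le> ereal (ln (y n) / ln (real n))"
        using lower[of m] ln eventually_gt_at_top[of 0]
      proof eventually_elim
        case (elim n)
        have "v n * ln (real n) = ln (real n powr (- 1 - \<epsilon>) / 2)"
          using elim by (simp add: v_def ln_div ln_powr algebra_simps)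
        also have "\<dots> \<le> ln (y n)"
          using elim by (intro ln_mono) (auto simp: \<epsilon>_def)
        finally show ?case
          using elim by (simp add: pos_le_divide_eq)
      qed
    qed
    finally show ?thesis by (simp add: \<epsilon>_def)
  qed
  show "ereal (- 1) \<le> liminf (\<lambda>n. ereal (ln (y n) / ln (real n)))"
  proof (rule LIMSEQ_le_const2)
    have "(\<lambda>m. - 1 - 1 / (real m + 2)) \<longlonglongrightarrow> - 1"
      by real_asymp
    then show "(\<lambda>m. ereal (- 1 - 1 / (real m + 2))) \<longlonglongrightarrow> ereal (- 1)"
      by simp
  qed (use bound in auto)
qed

section \<open>Variance of dyadic sums and an almost sure upper bound for normal sequences\<close>

lemma sum_dyadic_weights_bounds:
  assumes "m < n"
  shows "(\<Sum>j\<in>{m..<n}. (2 ^ j / 2 ^ n)\<^sup>2 :: real) \<ge> 1 / 4" "(\<Sum>j\<in>{m..<n}. (2 ^ j / 2 ^ n)\<^sup>2 :: real) \<le> 1"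
proof -
  \<comment> \<open>The last weight alone contributes 1/4, however short the block is. For the upper
    bound, each weight is at most 1 and so dominates its square, which leaves a geometric
    sum.\<close>
  have "(2 ^ (n - 1) / 2 ^ n)\<^sup>2 = (1 / 4 :: real)"
    using assms by (cases n) (auto simp: power_divide power2_eq_square)
  moreover have "(2 ^ (n - 1) / 2 ^ n)\<^sup>2 \<le> (\<Sum>j\<in>{m..<n}. (2 ^ j / 2 ^ n)\<^sup>2 :: real)"
    using assms by (intro member_le_sum) auto
  ultimately show "(\<Sum>j\<in>{m..<n}. (2 ^ j / 2 ^ n)\<^sup>2 :: real) \<ge> 1 / 4"
    by simp
  have "(\<Sum>j\<in>{m..<n}. (2 ^ j / 2 ^ n)\<^sup>2 :: real) \<le> (\<Sum>j<n. (2 ^ j / 2 ^ n)\<^sup>2)"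
    by (intro sum_mono2) auto
  also have "\<dots> \<le> (\<Sum>j<n. 2 ^ j / 2 ^ n)"
  proof (rule sum_mono)
    fix j assume "j \<in> {..<n}"
    then have "2 ^ j / 2 ^ n \<le> (1 :: real)"
      by simp
    then show "(2 ^ j / 2 ^ n)\<^sup>2 \<le> (2 ^ j / 2 ^ n :: real)"
      unfolding power2_eq_square by (intro mult_left_le) auto
  qed
  also have "\<dots> = (2 ^ n - 1) / 2 ^ n"
    by (simp add: sum_divide_distrib[symmetric] geometric_sum)
  also have "\<dots> \<le> 1"
    by simp
  finally show "(\<Sum>j\<in>{m..<n}. (2 ^ j / 2 ^ n)\<^sup>2 :: real) \<le> 1" .
qed

text \<open>With \<open>t^2 = 8 * ln n\<close> and \<open>\<sigma> <= 1\<close> the tail bound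
  becomes \<open>sqrt 2 / n^2\<close>, which is summable. No joint law enters, so the lemma applies
  both to \<open>Z\<close> and to \<open>\<xi>\<close>.\<close>

lemma (in prob_space) AE_normal_eventually_upper:
  fixes Y :: "nat \<Rightarrow> 'a \<Rightarrow> real"
  assumes Y: "\<And>n. n \<ge> 1 \<Longrightarrow> \<exists>\<sigma>>0. \<sigma> \<le> 1 \<and> distributed M lborel (Y n) (normal_density 0 \<sigma>)"
    and [measurable]: "\<And>n. Y n \<in> borel_measurable M"
  shows "AE \<omega> in M. \<forall>\<^sub>F n in sequentially. \<bar>Y n \<omega>\<bar> \<le> sqrt (8 * ln (real n))"
proof -
  have "AE \<omega> in M. \<forall>\<^sub>F n in sequentially. \<not> sqrt (8 * ln (real n)) \<le> \<bar>Y n \<omega>\<bar>"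
  proof (rule AE_eventually_notI)
    show "{\<omega>\<in>space M. sqrt (8 * ln (real n)) \<le> \<bar>Y n \<omega>\<bar>} \<in> events" for n
      by measurable
    show "\<forall>\<^sub>F n in sequentially. prob {\<omega>\<in>space M. sqrt (8 * ln (real n)) \<le> \<bar>Y n \<omega>\<bar>}
        \<le> sqrt 2 * inverse (real n ^ 2)"
      using eventually_ge_at_top[of 1]
    proof eventually_elim
      case (elim n)
      then obtain \<sigma> where \<sigma>: "0 < \<sigma>" "\<sigma> \<le> 1" "distributed M lborel (Y n) (normal_density 0 \<sigma>)"
        using Y by blast
      have "ln (real n) \<ge> 0"
        using elim by simp
      then have "prob {\<omega>\<in>space M. sqrt (8 * ln (real n)) \<le> \<bar>Y n \<omega>\<bar>}
          \<le> sqrt 2 * exp (- (2 * ln (real n) / \<sigma>\<^sup>2))"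
        using normal_prob_abs_ge[OF \<sigma>(3,1), of "sqrt (8 * ln (real n))"] by simp
      also have "\<dots> \<le> sqrt 2 * exp (- (2 * ln (real n)))"
      proof -
        have "2 * ln (real n) * \<sigma>\<^sup>2 \<le> 2 * ln (real n)"
          using \<sigma> \<open>ln (real n) \<ge> 0\<close> by (intro mult_left_le) (auto simp: power_le_one)
        then show ?thesis
          using \<sigma> by (simp add: pos_le_divide_eq)
      qed
      also have "exp (- (2 * ln (real n))) = inverse (real n ^ 2)"
        using elim exp_of_nat_mult[of 2 "ln (real n)"] by (simp add: exp_minus)
      finally show ?case by simp
    qed
    show "summable (\<lambda>n. sqrt 2 * inverse (real n ^ 2))"
      by (intro summable_mult inverse_power_summable) auto
  qed
  then show ?thesis
    by (rule AE_mp) (auto intro!: AE_I2 elim: eventually_mono)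
qed

subsection \<open>Weighted sums of a standard normal sequence\<close>

text \<open>The factor 3 gives \<open>2 ^ block_gap i >= (i + 1)^3\<close>, a discount that beats
  the linear bound on \<open>Z\<close> at the previous block start.\<close>

definition block_gap :: "nat \<Rightarrow> nat" where
  "block_gap i = nat \<lceil>3 * log 2 (real i + 1)\<rceil>"

text \<open>These sampling times \<open>n\<close> grow like \<open>i * ln i\<close>, so
  \<open>1 / i\<close> is of order \<open>ln n / n\<close> and still has logarithmic exponent
  -1.\<close>

definition block_start :: "nat \<Rightarrow> nat" where
  "block_start i = i * block_gap i"

lemma block_gap_le: "real (block_gap i) \<le> 3 * log 2 (real i + 1) + 1"
proof -
  have "0 \<le> log 2 (real i + 1)"
    by simp
  then show ?thesis
    unfolding block_gap_def by linarith
qed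

lemma block_gap_ge: "3 * log 2 (real i + 1) \<le> real (block_gap i)"
  unfolding block_gap_def by (simp add: real_nat_ceiling_ge)

lemma mono_block_gap: "i \<le> j \<Longrightarrow> block_gap i \<le> block_gap j"
  unfolding block_gap_def by (intro nat_mono ceiling_mono mult_left_mono log_mono) auto

lemma block_gap_Suc_ge: "block_gap (Suc i) \<ge> 1"
proof -
  have "1 \<le> log 2 (real (Suc i) + 1)"
    by (subst le_log_iff) auto
  then show ?thesis
    using block_gap_ge[of "Suc i"] by linarith
qed

text \<open>Write \<open>(i + 1) * g (i + 1) = g (i + 1) + i * g (i + 1)\<close> with
  \<open>g = block_gap\<close>, and use that \<open>g\<close> is monotone.\<close>

lemma block_start_Suc_ge: "block_start (Suc i) \<ge> block_start i + block_gap (Suc i)"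
  using mono_block_gap[of i "Suc i"] by (simp add: block_start_def)

lemma block_start_less_Suc: "block_start i < block_start (Suc i)"
  using block_start_Suc_ge[of i] block_gap_Suc_ge[of i] by simp

lemma two_power_block_gap_ge: "2 ^ block_gap i \<ge> (real i + 1) ^ 3"
proof -
  have "(real i + 1) ^ 3 = (2 powr log 2 (real i + 1)) powr 3"
    by simp
  also have "\<dots> = 2 powr (3 * log 2 (real i + 1))"
    by (simp only: powr_powr mult.commute)
  also have "\<dots> \<le> 2 powr real (block_gap i)"
    using block_gap_ge by (intro powr_mono) auto
  finally show ?thesis
    by (simp add: powr_realpow)
qed

section \<open>Almost sure behaviour of dyadic averages\<close>

locale std_normal_sequence = prob_space M for M :: "'a measure" +
  fixes \<xi> :: "nat \<Rightarrow> 'a \<Rightarrow> real"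
  assumes indep: "indep_vars (\<lambda>_. borel) \<xi> UNIV"
    and normal: "distributed M lborel (\<xi> j) std_normal_density"
begin

lemma measurable_\<xi> [measurable]: "\<xi> j \<in> borel_measurable M"
  using normal[of j] by (auto simp: distributed_def)

text \<open>An autoregressive sequence: \<open>Z 0 = 0\<close> and
  \<open>Z (n + 1) = (Z n + \<xi> n) / 2\<close>.\<close>

definition Z :: "nat \<Rightarrow> 'a \<Rightarrow> real" where
  "Z n \<omega> = (\<Sum>j<n. 2 ^ j * \<xi> j \<omega>) / 2 ^ n"

lemma measurable_Z [measurable]: "Z n \<in> borel_measurable M"
  unfolding Z_def by measurable

lemma block_normal:
  assumes "m < n"
  obtains \<sigma> where "1 / 2 \<le> \<sigma>" "\<sigma> \<le> 1"
    "distributed M lborel (\<lambda>\<omega>. \<Sum>j\<in>{m..<n}. 2 ^ j / 2 ^ n * \<xi> j \<omega>) (normal_density 0 \<sigma>)"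
proof
  let ?\<sigma> = "sqrt (\<Sum>j\<in>{m..<n}. (2 ^ j / 2 ^ n)\<^sup>2)"
  have "(1 / 2)\<^sup>2 = (1 / 4 :: real)"
    by (simp add: power2_eq_square)
  then show "1 / 2 \<le> ?\<sigma>"
    using sum_dyadic_weights_bounds(1)[OF assms] by (intro real_le_rsqrt) simp
  show "?\<sigma> \<le> 1"
    using sum_dyadic_weights_bounds(2)[OF assms] by simp
  show "distributed M lborel (\<lambda>\<omega>. \<Sum>j\<in>{m..<n}. 2 ^ j / 2 ^ n * \<xi> j \<omega>) (normal_density 0 ?\<sigma>)"
    using assms
    by (intro distributed_weighted_sum_normal indep_vars_subset[OF indep] normal) auto
qed

lemma Z_normal:
  assumes "n \<ge> 1"
  obtains \<sigma> where "1 / 2 \<le> \<sigma>" "\<sigma> \<le> 1" "distributed M lborel (Z n) (normal_density 0 \<sigma>)"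
proof -
  have "(\<lambda>\<omega>. \<Sum>j\<in>{0..<n}. 2 ^ j / 2 ^ n * \<xi> j \<omega>) = Z n"
    by (auto simp: Z_def sum_divide_distrib lessThan_atLeast0)
  then show ?thesis
    using block_normal[of 0 n] assms that by auto
qed

lemma AE_Z_upper: "AE \<omega> in M. \<forall>\<^sub>F n in sequentially. \<bar>Z n \<omega>\<bar> \<le> sqrt (8 * ln (real n))"
proof (rule AE_normal_eventually_upper)
  fix n :: nat assume "n \<ge> 1"
  then obtain \<sigma> where "1 / 2 \<le> \<sigma>" "\<sigma> \<le> 1" "distributed M lborel (Z n) (normal_density 0 \<sigma>)"
    by (rule Z_normal)
  then show "\<exists>\<sigma>>0. \<sigma> \<le> 1 \<and> distributed M lborel (Z n) (normal_density 0 \<sigma>)"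
    by (intro exI[of _ \<sigma>]) auto
qed auto

text \<open>The almost sure bound \<open>sqrt (8 * ln n)\<close> is eventually below
  \<open>n + 1\<close>, and \<open>C\<close> absorbs the finitely many exceptions. This allows the
  approximation to be carried out outcome by outcome.\<close>

lemma AE_linear_bound: "AE \<omega> in M. \<exists>C. \<forall>j. \<bar>\<xi> j \<omega>\<bar> \<le> C * (real j + 1)"
proof -
  have "AE \<omega> in M. \<forall>\<^sub>F n in sequentially. \<bar>\<xi> n \<omega>\<bar> \<le> sqrt (8 * ln (real n))"
    using normal by (intro AE_normal_eventually_upper exI[of _ 1]) auto
  then show ?thesis
  proof (rule AE_mp, intro AE_I2 impI)
    fix \<omega> assume "\<forall>\<^sub>F n in sequentially. \<bar>\<xi> n \<omega>\<bar> \<le> sqrt (8 * ln (real n))"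
    moreover have "\<forall>\<^sub>F n in sequentially. sqrt (8 * ln (real n)) \<le> real n + 1"
      by real_asymp
    ultimately have "\<forall>\<^sub>F n in sequentially. \<bar>\<xi> n \<omega>\<bar> \<le> real n + 1"
      by eventually_elim simp
    then obtain N where N: "\<And>n. n \<ge> N \<Longrightarrow> \<bar>\<xi> n \<omega>\<bar> \<le> real n + 1"
      by (auto simp: eventually_sequentially)
    define C where "C = 1 + (\<Sum>j<N. \<bar>\<xi> j \<omega>\<bar>)"
    have "C \<ge> 1"
      by (simp add: C_def sum_nonneg)
    have "\<bar>\<xi> j \<omega>\<bar> \<le> C * (real j + 1)" for j
    proof (cases "j < N")
      case True
      then have "\<bar>\<xi> j \<omega>\<bar> \<le> (\<Sum>j<N. \<bar>\<xi> j \<omega>\<bar>)"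
        by (intro member_le_sum) auto
      then have "\<bar>\<xi> j \<omega>\<bar> \<le> C"
        by (simp add: C_def)
      also have "\<dots> \<le> C * (real j + 1)"
        using \<open>C \<ge> 1\<close> by (simp add: algebra_simps)
      finally show ?thesis .
    next
      case False
      then have "\<bar>\<xi> j \<omega>\<bar> \<le> 1 * (real j + 1)"
        using N[of j] by simp
      also have "\<dots> \<le> C * (real j + 1)"
        using \<open>C \<ge> 1\<close> by (intro mult_right_mono) auto
      finally show ?thesis .
    qed
    then show "\<exists>C. \<forall>j. \<bar>\<xi> j \<omega>\<bar> \<le> C * (real j + 1)"
      by blast
  qed
qed

text \<open>As \<open>\<sigma> >= 1 / 2\<close>, the exceptional probabilities are at most
  \<open>2 * n powr (- 1 - 1 / (m + 2))\<close>, hence summable; countably many \<open>m\<close>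
  share one null set.\<close>

lemma AE_Z_lower:
  "AE \<omega> in M. \<forall>m. \<forall>\<^sub>F n in sequentially. \<bar>Z n \<omega>\<bar> \<ge> real n powr (- 1 - 1 / (real m + 2))"
proof -
  have "AE \<omega> in M. \<forall>\<^sub>F n in sequentially. \<not> \<bar>Z n \<omega>\<bar> \<le> real n powr (- 1 - 1 / (real m + 2))" for m :: nat
  proof (rule AE_eventually_notI)
    show "{\<omega>\<in>space M. \<bar>Z n \<omega>\<bar> \<le> real n powr (- 1 - 1 / (real m + 2))} \<in> events" for n
      by measurable
    show "\<forall>\<^sub>F n in sequentially. prob {\<omega>\<in>space M. \<bar>Z n \<omega>\<bar> \<le> real n powr (- 1 - 1 / (real m + 2))}
        \<le> 2 * real n powr (- 1 - 1 / (real m + 2))"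
      using eventually_ge_at_top[of 1]
    proof eventually_elim
      case (elim n)
      then obtain \<sigma> where \<sigma>: "1 / 2 \<le> \<sigma>" "\<sigma> \<le> 1" "distributed M lborel (Z n) (normal_density 0 \<sigma>)"
        by (rule Z_normal)
      define x where "x = real n powr (- 1 - 1 / (real m + 2))"
      have "prob {\<omega>\<in>space M. \<bar>Z n \<omega>\<bar> \<le> x} \<le> x / \<sigma>"
        using \<sigma> by (intro normal_prob_abs_le) (auto simp: x_def)
      also have "\<dots> \<le> x / (1 / 2)"
        using \<sigma> by (intro divide_left_mono) (auto simp: x_def)
      finally show ?case by (simp add: x_def)
    qed
    show "summable (\<lambda>n. 2 * real n powr (- 1 - 1 / (real m + 2)))"
      by (intro summable_mult) (simp add: summable_real_powr_iff)
  qed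
  then have "AE \<omega> in M. \<forall>m :: nat. \<forall>\<^sub>F n in sequentially. \<not> \<bar>Z n \<omega>\<bar> \<le> real n powr (- 1 - 1 / (real m + 2))"
    by (simp add: AE_all_countable)
  then show ?thesis
  proof (rule AE_mp, intro AE_I2 impI allI)
    fix \<omega> and m :: nat
    assume "\<forall>m :: nat. \<forall>\<^sub>F n in sequentially. \<not> \<bar>Z n \<omega>\<bar> \<le> real n powr (- 1 - 1 / (real m + 2))"
    then have "\<forall>\<^sub>F n in sequentially. \<not> \<bar>Z n \<omega>\<bar> \<le> real n powr (- 1 - 1 / (real m + 2))"
      by blast
    then show "\<forall>\<^sub>F n in sequentially. \<bar>Z n \<omega>\<bar> \<ge> real n powr (- 1 - 1 / (real m + 2))"
      by eventually_elim simp
  qed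
qed

lemma AE_frequently_large: "AE \<omega> in M. \<exists>\<^sub>F j in sequentially. \<xi> j \<omega> \<ge> sqrt (ln (real j))"
proof (rule AE_frequentlyI_indep_vars[OF indep])
  \<comment> \<open>The unit interval starting at \<open>t = sqrt (ln n)\<close> has probability at
    least the density at \<open>t + 1\<close>. From \<open>(t + 1)^2 <= 2 * t^2 + 2\<close> this
    density is at least \<open>c / n\<close>.\<close>
  define c where "c = exp (- 1) / sqrt (2 * pi)"
  have "c > 0"
    by (simp add: c_def)
  show "{x :: real. x \<ge> sqrt (ln (real j))} \<in> sets borel" for j
    by measurable
  show "\<forall>\<^sub>F n in sequentially. c * inverse (real n) \<ge> 0"
    using \<open>c > 0\<close> by simp
  show "\<not> summable (\<lambda>n. c * inverse (real n))"
    using \<open>c > 0\<close> not_summable_harmonic[where 'a = real] by (simp add: summable_cmult_iff)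
  show "\<forall>\<^sub>F n in sequentially. c * inverse (real n) \<le> prob {\<omega>\<in>space M. \<xi> n \<omega> \<ge> sqrt (ln (real n))}"
    using eventually_ge_at_top[of 1]
  proof eventually_elim
    case (elim n)
    define t where "t = sqrt (ln (real n))"
    have t: "t \<ge> 0" "t\<^sup>2 = ln (real n)"
      using elim by (auto simp: t_def)
    have "(t + 1)\<^sup>2 \<le> 2 * t\<^sup>2 + 2"
      using zero_le_power2[of "t - 1"] by (simp add: power2_eq_square algebra_simps)
    then have "exp (- t\<^sup>2 - 1) \<le> exp (- (t + 1)\<^sup>2 / 2)"
      by simp
    moreover have "exp (- t\<^sup>2 - 1) = exp (- 1) * inverse (real n)"
      using elim unfolding t by (simp add: exp_diff exp_minus divide_inverse mult.commute)
    ultimately have "c * inverse (real n) \<le> std_normal_density (t + 1)"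
      by (simp add: c_def std_normal_density_def divide_right_mono)
    also have "\<dots> \<le> prob {\<omega>\<in>space M. t \<le> \<xi> n \<omega> \<and> \<xi> n \<omega> \<le> t + 1}"
      using normal_prob_interval_ge[OF normal, of t 1 n] t by simp
    also have "\<dots> \<le> prob {\<omega>\<in>space M. \<xi> n \<omega> \<ge> t}"
      by (intro finite_measure_mono) auto
    finally show ?case by (simp add: t_def)
  qed
qed

lemma AE_frequently_block_small:
  "AE \<omega> in M. \<exists>\<^sub>F i in sequentially.
    \<bar>\<Sum>j\<in>{block_start i..<block_start (Suc i)}. 2 ^ j / 2 ^ block_start (Suc i) * \<xi> j \<omega>\<bar> \<le> 1 / real (Suc i)"
proof -
  let ?W = "\<lambda>i \<omega>. \<Sum>j\<in>{block_start i..<block_start (Suc i)}. 2 ^ j / 2 ^ block_start (Suc i) * \<xi> j \<omega>"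
  \<comment> \<open>A lower bound for the densities on \<open>[0, 1]\<close> over all
    \<open>\<sigma>\<close> in \<open>[1/2, 1]\<close>: \<open>\<sigma> = 1/2\<close> is the worst
    case in the exponent, \<open>\<sigma> = 1\<close> in the normalization.\<close>
  define c where "c = exp (- 2) / sqrt (2 * pi)"
  have "c > 0"
    by (simp add: c_def)
  have "mono block_start"
    using block_start_less_Suc by (auto simp: mono_iff_le_Suc less_imp_le)
  \<comment> \<open>The blocks are the increments of the increasing sets
    \<open>{..<block_start i}\<close>.\<close>
  then have "disjoint_family (\<lambda>i. {..<block_start (Suc i)} - {..<block_start i})"
    by (intro disjoint_family_Suc) (auto simp: mono_iff_le_Suc intro: less_le_trans)
  moreover have "{..<block_start (Suc i)} - {..<block_start i} = {block_start i..<block_start (Suc i)}" for i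
    by auto
  ultimately have "disjoint_family (\<lambda>i. {block_start i..<block_start (Suc i)})"
    by simp
  then have indep_W: "indep_vars (\<lambda>_. borel) ?W UNIV"
    by (intro indep_vars_block_sums[OF indep]) auto
  show ?thesis
  proof (rule AE_frequentlyI_indep_vars[where Y = ?W, OF indep_W])
    show "{x :: real. \<bar>x\<bar> \<le> 1 / real (Suc i)} \<in> sets borel" for i
      by measurable
    show "\<forall>\<^sub>F i in sequentially. c * inverse (real (Suc i)) \<ge> 0"
      using \<open>c > 0\<close> by simp
    show "\<not> summable (\<lambda>i. c * inverse (real (Suc i)))"
      using \<open>c > 0\<close> not_summable_harmonic[where 'a = real]
        summable_Suc_iff[of "\<lambda>i. inverse (real i)"] by (simp add: summable_cmult_iff)
    show "\<forall>\<^sub>F i in sequentially. c * inverse (real (Suc i)) \<le> prob {\<omega>\<in>space M. \<bar>?W i \<omega>\<bar> \<le> 1 / real (Suc i)}"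
    proof (rule always_eventually, rule allI)
      fix i
      obtain \<sigma> where \<sigma>: "1 / 2 \<le> \<sigma>" "\<sigma> \<le> 1" "distributed M lborel (?W i) (normal_density 0 \<sigma>)"
        using block_normal[OF block_start_less_Suc] .
      define h where "h = 1 / real (Suc i)"
      have h: "0 \<le> h" "h \<le> 1"
        by (auto simp: h_def)
      have "(1 / 2)\<^sup>2 \<le> \<sigma>\<^sup>2"
        using \<sigma> by (intro power_mono) auto
      moreover have "h\<^sup>2 \<le> 1"
        using h by (simp add: power_le_one)
      ultimately have "h\<^sup>2 / (2 * \<sigma>\<^sup>2) \<le> 2"
        using \<sigma> by (simp add: pos_divide_le_eq power2_eq_square)
      then have "exp (- 2) \<le> exp (- h\<^sup>2 / (2 * \<sigma>\<^sup>2))"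
        by simp
      moreover have "sqrt (2 * pi * \<sigma>\<^sup>2) \<le> sqrt (2 * pi)"
        using \<sigma> by (intro real_sqrt_le_mono mult_left_le) (auto simp: power_le_one)
      ultimately have "c \<le> exp (- h\<^sup>2 / (2 * \<sigma>\<^sup>2)) / sqrt (2 * pi * \<sigma>\<^sup>2)"
        unfolding c_def using \<sigma> by (intro frac_le) auto
      then have "c \<le> normal_density 0 \<sigma> (0 + h)"
        by (simp add: normal_density_def)
      then have "h * c \<le> h * normal_density 0 \<sigma> (0 + h)"
        using h(1) by (rule mult_left_mono)
      moreover have "c * inverse (real (Suc i)) = h * c"
        by (simp add: h_def divide_inverse)
      ultimately have "c * inverse (real (Suc i)) \<le> h * normal_density 0 \<sigma> (0 + h)"
        by (simp only:)
      also have "\<dots> \<le> prob {\<omega>\<in>space M. 0 \<le> ?W i \<omega> \<and> ?W i \<omega> \<le> 0 + h}"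
        using \<sigma> h by (intro normal_prob_interval_ge) auto
      also have "\<dots> \<le> prob {\<omega>\<in>space M. \<bar>?W i \<omega>\<bar> \<le> 1 / real (Suc i)}"
        unfolding h_def by (intro finite_measure_mono) auto
      finally show "c * inverse (real (Suc i)) \<le> prob {\<omega>\<in>space M. \<bar>?W i \<omega>\<bar> \<le> 1 / real (Suc i)}" .
    qed
  qed
qed

lemma Z_split:
  assumes "m \<le> n"
  shows "Z n \<omega> = (\<Sum>j\<in>{m..<n}. 2 ^ j / 2 ^ n * \<xi> j \<omega>) + Z m \<omega> / 2 ^ (n - m)"
proof -
  have "(\<Sum>j<n. 2 ^ j * \<xi> j \<omega>) = (\<Sum>j<m. 2 ^ j * \<xi> j \<omega>) + (\<Sum>j\<in>{m..<n}. 2 ^ j * \<xi> j \<omega>)"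
    using sum.atLeastLessThan_concat[of 0 m n "\<lambda>j. 2 ^ j * \<xi> j \<omega>"] assms
    by (simp add: lessThan_atLeast0)
  moreover have "(2 :: real) ^ n = 2 ^ m * 2 ^ (n - m)"
    using assms by (simp flip: power_add)
  ultimately show ?thesis
    by (simp add: Z_def sum_divide_distrib[symmetric] add_divide_distrib)
qed

lemma abs_Z_le:
  assumes "\<And>j. \<bar>\<xi> j \<omega>\<bar> \<le> C * (real j + 1)"
  shows "\<bar>Z n \<omega>\<bar> \<le> C * real n"
proof -
  have "\<bar>\<Sum>j<n. 2 ^ j * \<xi> j \<omega>\<bar> \<le> (\<Sum>j<n. \<bar>2 ^ j * \<xi> j \<omega>\<bar>)"
    by (rule sum_abs)
  also have "\<dots> = (\<Sum>j<n. 2 ^ j * \<bar>\<xi> j \<omega>\<bar>)"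
    by (simp add: abs_mult)
  also have "\<dots> \<le> C * real n * 2 ^ n"
    using assms by (rule weighted_partial_sum_bound)
  finally show ?thesis
    by (simp add: Z_def pos_divide_le_eq)
qed

text \<open>At the end of a block, \<open>Z\<close> is the block sum plus the old value
  \<open>Z (block_start i)\<close> divided by at least \<open>(i + 2)^3\<close>. The old value is
  \<open>O(i * ln i)\<close> for the given outcome, so the remainder is eventually at most
  \<open>1 / (i + 1)\<close>.\<close>

lemma AE_frequently_Z_small:
  "AE \<omega> in M. \<exists>\<^sub>F i in sequentially. \<bar>Z (block_start (Suc i)) \<omega>\<bar> \<le> 2 / real (Suc i)"
  using AE_linear_bound AE_frequently_block_small
proof eventually_elim
  case (elim \<omega>)
  then obtain C where C: "\<And>j. \<bar>\<xi> j \<omega>\<bar> \<le> C * (real j + 1)"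
    by blast
  then have "C \<ge> 0"
    using C[of 0] by simp
  let ?W = "\<lambda>i. \<Sum>j\<in>{block_start i..<block_start (Suc i)}. 2 ^ j / 2 ^ block_start (Suc i) * \<xi> j \<omega>"
  have "(\<lambda>i. real (Suc i) * (real i * (3 * log 2 (real i + 1) + 1)) / (real i + 2) ^ 3) \<longlonglongrightarrow> 0"
    by real_asymp
  then have "(\<lambda>i. C * (real (Suc i) * (real i * (3 * log 2 (real i + 1) + 1)) / (real i + 2) ^ 3)) \<longlonglongrightarrow> C * 0"
    by (intro tendsto_intros)
  then have "\<forall>\<^sub>F i in sequentially. C * (real (Suc i) * (real i * (3 * log 2 (real i + 1) + 1)) / (real i + 2) ^ 3) < 1"
    by (rule order_tendstoD) auto
  then have "\<forall>\<^sub>F i in sequentially. \<bar>?W i\<bar> \<le> 1 / real (Suc i) \<longrightarrow> \<bar>Z (block_start (Suc i)) \<omega>\<bar> \<le> 2 / real (Suc i)"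
  proof eventually_elim
    case (elim i)
    define R where "R = Z (block_start i) \<omega> / 2 ^ (block_start (Suc i) - block_start i)"
    have "(real i + 2) ^ 3 \<le> (2 :: real) ^ block_gap (Suc i)"
      using two_power_block_gap_ge[of "Suc i"] by (simp add: algebra_simps)
    also have "\<dots> \<le> 2 ^ (block_start (Suc i) - block_start i)"
      using block_start_Suc_ge[of i] by (intro power_increasing) auto
    finally have "\<bar>R\<bar> \<le> \<bar>Z (block_start i) \<omega>\<bar> / (real i + 2) ^ 3"
      unfolding R_def abs_divide by (intro frac_le) auto
    also have "\<dots> \<le> C * (real i * (3 * log 2 (real i + 1) + 1)) / (real i + 2) ^ 3"
    proof (intro divide_right_mono)
      have "\<bar>Z (block_start i) \<omega>\<bar> \<le> C * real (block_start i)"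
        using C by (rule abs_Z_le)
      also have "\<dots> \<le> C * (real i * (3 * log 2 (real i + 1) + 1))"
        unfolding block_start_def of_nat_mult using \<open>C \<ge> 0\<close> block_gap_le[of i]
        by (intro mult_left_mono) auto
      finally show "\<bar>Z (block_start i) \<omega>\<bar> \<le> C * (real i * (3 * log 2 (real i + 1) + 1))" .
    qed auto
    also have "\<dots> \<le> 1 / real (Suc i)"
      using elim by (subst pos_le_divide_eq) (simp_all add: mult_ac del: of_nat_Suc)
    finally have "\<bar>R\<bar> \<le> 1 / real (Suc i)" .
    moreover have "Z (block_start (Suc i)) \<omega> = ?W i + R"
      unfolding R_def using block_start_less_Suc[of i] by (intro Z_split) simp
    moreover have "2 / real (Suc i) = 1 / real (Suc i) + 1 / real (Suc i)"
      by simp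
    ultimately show ?case
      by linarith
  qed
  with elim(2) show ?case
    by (rule frequently_rev_mp)
qed

end

section \<open>Transfer to sequences close to the absolute value of \<open>Z\<close>\<close>

context std_normal_sequence
begin

text \<open>If \<open>y\<close> were eventually below the threshold,
  \<open>\<xi> n = 2 * Z (n + 1) - Z n\<close> would be at most about
  \<open>3/16 * sqrt (ln n)\<close>, against its frequent large values. Quantifying over
  \<open>y\<close> inside \<open>AE\<close> makes the null set independent of
  \<open>y\<close>.\<close>

lemma AE_frequently_large_perturbation:
  "AE \<omega> in M. \<forall>y. (\<forall>\<^sub>F n in sequentially. \<bar>y n - \<bar>Z n \<omega>\<bar>\<bar> \<le> 1 / (real n)\<^sup>2)
     \<longrightarrow> (\<exists>\<^sub>F n in sequentially. y n \<ge> sqrt (ln (real n)) / 16)"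
  using AE_frequently_large
proof eventually_elim
  case (elim \<omega>)
  show ?case
  proof (intro allI impI, unfold frequently_def, rule notI)
    fix y :: "nat \<Rightarrow> real"
    assume y: "\<forall>\<^sub>F n in sequentially. \<bar>y n - \<bar>Z n \<omega>\<bar>\<bar> \<le> 1 / (real n)\<^sup>2"
      and small: "\<forall>\<^sub>F n in sequentially. \<not> sqrt (ln (real n)) / 16 \<le> y n"
    define u where "u n = sqrt (ln (real n)) / 16 + 1 / (real n)\<^sup>2" for n
    have Z: "\<forall>\<^sub>F n in sequentially. \<bar>Z n \<omega>\<bar> \<le> u n"
      using y small by eventually_elim (auto simp: u_def)
    then have "\<forall>\<^sub>F n in sequentially. \<bar>Z (Suc n) \<omega>\<bar> \<le> u (Suc n)"
      by (rule eventually_sequentially_Suc[THEN iffD2])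
    moreover have "\<forall>\<^sub>F n in sequentially. 2 * u (Suc n) + u n < sqrt (ln (real n))"
      unfolding u_def by real_asymp
    ultimately have "\<forall>\<^sub>F n in sequentially. \<not> sqrt (ln (real n)) \<le> \<xi> n \<omega>"
      using Z
    proof eventually_elim
      case (elim n)
      have "\<xi> n \<omega> = 2 * Z (Suc n) \<omega> - Z n \<omega>"
        by (simp add: Z_def field_simps)
      then show ?case
        using elim by linarith
    qed
    with elim show False
      by (simp add: frequently_def)
  qed
qed

text \<open>At \<open>n = (i + 1) * g\<close> with \<open>g = block_gap (Suc i)\<close> one has
  \<open>1 / (i + 1) = g / n\<close>, and \<open>g\<close> is at most logarithmic in
  \<open>n\<close>. The perturbation \<open>1 / n^2 <= 1 / (i + 1)\<close> raises the constant from
  2 to 3.\<close>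

lemma AE_frequently_small_perturbation:
  "AE \<omega> in M. \<forall>y. (\<forall>\<^sub>F n in sequentially. \<bar>y n - \<bar>Z n \<omega>\<bar>\<bar> \<le> 1 / (real n)\<^sup>2)
     \<longrightarrow> (\<exists>\<^sub>F n in sequentially. y n \<le> 3 * (3 * log 2 (real n + 1) + 1) / real n)"
  using AE_frequently_Z_small
proof eventually_elim
  case (elim \<omega>)
  show ?case
  proof (intro allI impI, unfold frequently_def, rule notI)
    fix y :: "nat \<Rightarrow> real"
    assume y: "\<forall>\<^sub>F n in sequentially. \<bar>y n - \<bar>Z n \<omega>\<bar>\<bar> \<le> 1 / (real n)\<^sup>2"
      and large: "\<forall>\<^sub>F n in sequentially. \<not> y n \<le> 3 * (3 * log 2 (real n + 1) + 1) / real n"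
    have "strict_mono (\<lambda>i. block_start (Suc i))"
      unfolding strict_mono_Suc_iff using block_start_less_Suc by blast
    then have "filterlim (\<lambda>i. block_start (Suc i)) at_top sequentially"
      by (rule filterlim_subseq)
    from eventually_compose_filterlim[OF eventually_conj[OF y large] this]
    have "\<forall>\<^sub>F i in sequentially. \<not> \<bar>Z (block_start (Suc i)) \<omega>\<bar> \<le> 2 / real (Suc i)"
    proof eventually_elim
      case (elim i)
      define n where "n = block_start (Suc i)"
      define g where "g = block_gap (Suc i)"
      have n: "n = Suc i * g" "g \<ge> 1"
        using block_gap_Suc_ge[of i] by (simp_all add: n_def g_def block_start_def)
      have "Suc i \<le> n"
        using n mult_le_mono2[of 1 g "Suc i"] by simp
      have "real g \<le> 3 * log 2 (real (Suc i) + 1) + 1"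
        unfolding g_def by (rule block_gap_le)
      also have "\<dots> \<le> 3 * log 2 (real n + 1) + 1"
        using \<open>Suc i \<le> n\<close> by simp
      finally have g: "real g \<le> 3 * log 2 (real n + 1) + 1" .
      have "1 / (real n)\<^sup>2 \<le> 1 / real n"
        using \<open>Suc i \<le> n\<close> by (intro divide_left_mono) (auto simp: power2_eq_square)
      also have "\<dots> \<le> 1 / real (Suc i)"
        using \<open>Suc i \<le> n\<close> by (intro divide_left_mono) auto
      finally have "1 / (real n)\<^sup>2 \<le> 1 / real (Suc i)" .
      moreover have "3 / real (Suc i) = 3 * real g / real n"
        unfolding n(1) of_nat_mult using n(2) by (simp del: of_nat_Suc)
      moreover have "3 * real g / real n \<le> 3 * (3 * log 2 (real n + 1) + 1) / real n"
        using g by (intro divide_right_mono mult_left_mono) auto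
      moreover have "3 / real (Suc i) = 2 / real (Suc i) + 1 / real (Suc i)"
        by (simp add: add_divide_distrib[symmetric])
      moreover have "\<bar>y n - \<bar>Z n \<omega>\<bar>\<bar> \<le> 1 / (real n)\<^sup>2"
        "\<not> y n \<le> 3 * (3 * log 2 (real n + 1) + 1) / real n"
        using elim by (auto simp: n_def)
      ultimately have "\<not> \<bar>Z n \<omega>\<bar> \<le> 2 / real (Suc i)"
        by linarith
      then show ?case
        by (simp add: n_def)
    qed
    with elim show False
      by (simp add: frequently_def)
  qed
qed

end

theorem theorem2:
  fixes M :: "'a measure" and \<eta> :: "nat \<Rightarrow> 'a \<Rightarrow> real"
  assumes "prob_space M"
    and "prob_space.indep_vars M (\<lambda>_. borel) \<eta> {1..}"
    and "\<And>k. k \<ge> 1 \<Longrightarrow> distributed M lborel (\<eta> k) std_normal_density"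
  shows "\<exists>a :: nat \<Rightarrow> real.
    \<not> summable (\<lambda>k. (a (Suc k))\<^sup>2 / real (Suc k)) \<and>
    (\<forall>s>0. summable (\<lambda>k. (a (Suc k))\<^sup>2 / real (Suc k) powr (1 + 2 * s))) \<and>
    (AE \<omega> in M. limsup (\<lambda>n. ereal
        ((ln \<bar>X a \<eta> (s_seq n) \<omega>\<bar> - real n * ln 2) / ln (ln (real n)))) = ereal (1 / 2)) \<and>
    (AE \<omega> in M. liminf (\<lambda>n. ereal
        ((ln \<bar>X a \<eta> (s_seq n) \<omega>\<bar> - real n * ln 2) / ln (real n))) = ereal (- 1))"
proof -
  interpret prob_space M by fact
  define \<xi> where "\<xi> j = \<eta> (Suc (sparse_index j))" for j
  interpret std_normal_sequence M \<xi>
  proof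
    \<comment> \<open>Singleton blocks at the sparse indices turn independence of
      \<open>\<eta>\<close> into independence of \<open>\<xi>\<close>.\<close>
    have "indep_vars (\<lambda>_. borel) (\<lambda>j \<omega>. \<Sum>i\<in>{Suc (sparse_index j)}. 1 * \<eta> i \<omega>) UNIV"
      using assms(2) strict_mono_eq[OF strict_mono_sparse_index]
      by (intro indep_vars_block_sums[where I = "{1..}"]) (auto simp: disjoint_family_on_def)
    then show "indep_vars (\<lambda>_. borel) \<xi> UNIV"
      by (simp add: \<xi>_def[abs_def])
    show "distributed M lborel (\<xi> j) std_normal_density" for j
      unfolding \<xi>_def by (intro assms(3)) simp
  qed
  define y where "y n \<omega> = \<bar>X sparse_coeff \<eta> (s_seq n) \<omega>\<bar> / 2 ^ n" for n \<omega>
  have approx: "AE \<omega> in M. \<forall>\<^sub>F n in sequentially. \<bar>y n \<omega> - \<bar>Z n \<omega>\<bar>\<bar> \<le> 1 / (real n)\<^sup>2"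
    using AE_linear_bound
  proof eventually_elim
    case (elim \<omega>)
    then obtain C where "\<And>j. \<bar>\<eta> (Suc (sparse_index j)) \<omega>\<bar> \<le> C * (real j + 1)"
      by (auto simp: \<xi>_def)
    from X_sparse_coeff_approximation[where \<eta> = \<eta> and \<omega> = \<omega>, OF this] show ?case
    proof eventually_elim
      case (elim n)
      have "y n \<omega> = \<bar>X sparse_coeff \<eta> (s_seq n) \<omega> / 2 ^ n\<bar>"
        by (simp add: y_def)
      with elim show ?case
        unfolding Z_def \<xi>_def by linarith
    qed
  qed
  have main: "AE \<omega> in M.
    limsup (\<lambda>n. ereal ((ln \<bar>X sparse_coeff \<eta> (s_seq n) \<omega>\<bar> - real n * ln 2) / ln (ln (real n)))) = ereal (1 / 2) \<and>
    liminf (\<lambda>n. ereal ((ln \<bar>X sparse_coeff \<eta> (s_seq n) \<omega>\<bar> - real n * ln 2) / ln (real n))) = ereal (- 1)"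
    using approx AE_Z_upper AE_Z_lower AE_frequently_large_perturbation AE_frequently_small_perturbation
  proof eventually_elim
    case (elim \<omega>)
    have lower: "\<forall>\<^sub>F n in sequentially. y n \<omega> \<ge> real n powr (- 1 - 1 / (real m + 2)) / 2" for m :: nat
    proof -
      define e where "e = 1 / (real m + 2)"
      \<comment> \<open>The shift by 2 in the exponent keeps \<open>e\<close> below 1, so that
        \<open>1 / n^2\<close> is eventually at most half of
        \<open>n powr (- 1 - e)\<close>.\<close>
      have "0 < e" "e < 1"
        by (auto simp: e_def)
      then have "\<forall>\<^sub>F n in sequentially. 1 / (real n)\<^sup>2 \<le> real n powr (- 1 - e) / 2"
        by real_asymp
      moreover have "\<forall>\<^sub>F n in sequentially. \<bar>Z n \<omega>\<bar> \<ge> real n powr (- 1 - e)"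
        using elim(3) by (simp add: e_def)
      ultimately show ?thesis
        using elim(1) unfolding e_def[symmetric] by eventually_elim linarith
    qed
    have pos: "\<forall>\<^sub>F n in sequentially. y n \<omega> > 0"
      using lower[of 0] eventually_gt_at_top[of 0]
    proof eventually_elim
      case (elim n)
      then have "real n powr (- 1 - 1 / (real 0 + 2)) / 2 > 0"
        by simp
      with elim show ?case by linarith
    qed
    \<comment> \<open>The logarithm of the quotient splits only where \<open>X\<close> is nonzero,
      which \<open>pos\<close> guarantees eventually; that is enough for both limits.\<close>
    have ln_y: "\<forall>\<^sub>F n in sequentially. ln \<bar>X sparse_coeff \<eta> (s_seq n) \<omega>\<bar> - real n * ln 2 = ln (y n \<omega>)"
      using pos by eventually_elim (auto simp: y_def ln_div ln_realpow)
    have "limsup (\<lambda>n. ereal ((ln \<bar>X sparse_coeff \<eta> (s_seq n) \<omega>\<bar> - real n * ln 2) / ln (ln (real n))))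
        = limsup (\<lambda>n. ereal (ln (y n \<omega>) / ln (ln (real n))))"
      by (rule Limsup_eq) (use ln_y in eventually_elim, simp)
    also have "\<dots> = ereal (1 / 2)"
    proof (rule limsup_ln_over_ln_ln[OF pos])
      show "\<forall>\<^sub>F n in sequentially. y n \<omega> \<le> sqrt (8 * ln (real n)) + 1 / (real n)\<^sup>2"
        using elim(1,2) by eventually_elim linarith
      show "\<exists>\<^sub>F n in sequentially. y n \<omega> \<ge> sqrt (ln (real n)) / 16"
        by (rule mp[OF spec[OF elim(4), of "\<lambda>n. y n \<omega>"] elim(1)])
    qed
    finally have "limsup (\<lambda>n. ereal ((ln \<bar>X sparse_coeff \<eta> (s_seq n) \<omega>\<bar> - real n * ln 2) / ln (ln (real n)))) = ereal (1 / 2)" .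
    moreover have "liminf (\<lambda>n. ereal ((ln \<bar>X sparse_coeff \<eta> (s_seq n) \<omega>\<bar> - real n * ln 2) / ln (real n)))
        = liminf (\<lambda>n. ereal (ln (y n \<omega>) / ln (real n)))"
      by (rule Liminf_eq) (use ln_y in eventually_elim, simp)
    moreover have "\<dots> = ereal (- 1)"
      by (rule liminf_ln_over_ln[OF lower mp[OF spec[OF elim(5), of "\<lambda>n. y n \<omega>"] elim(1)]])
    ultimately show ?case
      by simp
  qed
  show ?thesis
  proof (intro exI[of _ sparse_coeff] conjI allI impI)
    show "\<not> summable (\<lambda>k. (sparse_coeff (Suc k))\<^sup>2 / real (Suc k))"
      by (rule not_summable_sparse_coeff)
    show "summable (\<lambda>k. (sparse_coeff (Suc k))\<^sup>2 / real (Suc k) powr (1 + 2 * s))" if "s > 0" for s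
      using that by (rule summable_sparse_coeff)
  qed (use main in \<open>eventually_elim, simp\<close>)+
qed

end
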